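(* Let $p\in(0,1)$ and $f\in L^2(\{0,1\}^n,\mu_p)$, and suppose $\beta>0$ is such that $\|\mathrm{D}_Sf\|_2^2\le\beta\lambda^{-|S|}\mathbb{E}[f^2]$ for all $S\subseteq[n]$. Then $\|\mathrm{T}_{1/\sqrt{24}}f\|_4\le\beta^{1/4}\|f\|_2$.
   Context: All norms and expectations are with respect to the $p$-biased product measure $\mu_p$ on $\{0,1\}^n$. $\sigma=\sqrt{p(1-p)}$, $\chi_i(x)=(x_i-p)/\sigma$, $\chi_S=\prod_{i\in S}\chi_i$, $f=\sum_S\hat f(S)\chi_S$. $\mathrm{D}_Sf=\sum_{T\supseteq S}\hat f(T)\chi_{T\setminus S}$. $\lambda=\mathbb{E}_{\mu_p}[\chi_i^4]=\sigma^{-2}((1-p)^3+p^3)$. The noise operator satisfies $\mathrm{T}_\rho\chi_S=\rho^{|S|}\chi_S$ (equivalently: each coordinate kept with probability $\rho$, otherwise resampled from the $p$-biased bit). *)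

theory Defs
  imports "HOL-Probability.Probability"
begin

text \<open>
  A point of the cube \<open>{0,1}\<^sup>I\<close> over a finite index set \<open>I\<close> is a function \<open>'i \<Rightarrow> bool\<close>
  that is \<open>False\<close> outside \<open>I\<close> (the support of \<open>cube_pmf\<close> below).  A function on the cube is a
  function \<open>f :: ('i \<Rightarrow> bool) \<Rightarrow> real\<close>; only its values on that support matter.
\<close>

definition cube_pmf :: "real \<Rightarrow> 'i set \<Rightarrow> ('i \<Rightarrow> bool) pmf" where
  "cube_pmf p I = Pi_pmf I False (\<lambda>_. bernoulli_pmf p)"

abbreviation cube_expectation :: "real \<Rightarrow> 'i set \<Rightarrow> (('i \<Rightarrow> bool) \<Rightarrow> real) \<Rightarrow> real" where
  "cube_expectation p I f \<equiv> measure_pmf.expectation (cube_pmf p I) f"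

definition cube_norm :: "real \<Rightarrow> 'i set \<Rightarrow> real \<Rightarrow> (('i \<Rightarrow> bool) \<Rightarrow> real) \<Rightarrow> real" where
  "cube_norm p I q f = (cube_expectation p I (\<lambda>x. \<bar>f x\<bar> powr q)) powr (1 / q)"

definition std_dev :: "real \<Rightarrow> real" where
  "std_dev p = sqrt (p * (1 - p))"

definition chi1 :: "real \<Rightarrow> bool \<Rightarrow> real" where
  "chi1 p b = (of_bool b - p) / std_dev p"

definition chi :: "real \<Rightarrow> 'i set \<Rightarrow> ('i \<Rightarrow> bool) \<Rightarrow> real" where
  "chi p S x = (\<Prod>i\<in>S. chi1 p (x i))"

text \<open>
  The coefficients of the expansion in the orthonormal basis \<open>chi p S\<close>, \<open>S \<subseteq> I\<close>; see
  \<open>chi_orthonormal\<close> and \<open>fourier_expansion\<close> below.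
\<close>

definition fourier_coeff :: "real \<Rightarrow> 'i set \<Rightarrow> (('i \<Rightarrow> bool) \<Rightarrow> real) \<Rightarrow> 'i set \<Rightarrow> real" where
  "fourier_coeff p I f S = cube_expectation p I (\<lambda>x. f x * chi p S x)"

definition deriv_op ::
    "real \<Rightarrow> 'i set \<Rightarrow> 'i set \<Rightarrow> (('i \<Rightarrow> bool) \<Rightarrow> real) \<Rightarrow> ('i \<Rightarrow> bool) \<Rightarrow> real" where
  "deriv_op p I S f x = (\<Sum>T | S \<subseteq> T \<and> T \<subseteq> I. fourier_coeff p I f T * chi p (T - S) x)"

definition noise_op ::
    "real \<Rightarrow> 'i set \<Rightarrow> real \<Rightarrow> (('i \<Rightarrow> bool) \<Rightarrow> real) \<Rightarrow> ('i \<Rightarrow> bool) \<Rightarrow> real" where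
  "noise_op p I \<rho> f x = (\<Sum>S\<in>Pow I. \<rho> ^ card S * fourier_coeff p I f S * chi p S x)"

definition fourth_moment :: "real \<Rightarrow> real" where
  "fourth_moment p = measure_pmf.expectation (bernoulli_pmf p) (\<lambda>b. chi1 p b ^ 4)"


lemma fourth_moment_eq:
  assumes "0 < p" "p < 1"
  shows "fourth_moment p = ((1 - p) ^ 3 + p ^ 3) / (std_dev p)\<^sup>2"
proof -
  have s: "(std_dev p)\<^sup>2 = p * (1 - p)" "std_dev p \<noteq> 0"
    using assms by (auto simp: std_dev_def)
  have s4: "std_dev p ^ 4 = (p * (1 - p))\<^sup>2"
    by (metis s(1) power_mult numeral_Bit0 mult_2_right mult_2 power2_eq_square power_add)
  have "fourth_moment p = ((1 - p) ^ 4 * p + p ^ 4 * (1 - p)) / (p * (1 - p))\<^sup>2"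
    using assms unfolding fourth_moment_def chi1_def
    by (simp add: power_divide s4 add_divide_distrib)
  also have "(1 - p) ^ 4 * p + p ^ 4 * (1 - p) = (p * (1 - p)) * ((1 - p) ^ 3 + p ^ 3)"
    by (simp add: power3_eq_cube power4_eq_xxxx algebra_simps)
  also have "\<dots> / (p * (1 - p))\<^sup>2 = ((1 - p) ^ 3 + p ^ 3) / (p * (1 - p))"
    using assms by (simp add: power2_eq_square)
  finally show ?thesis by (simp add: s(1))
qed

lemma expectation_prod_cube:
  fixes g :: "'i \<Rightarrow> bool \<Rightarrow> real"
  assumes "finite I"
  shows "cube_expectation p I (\<lambda>x. \<Prod>i\<in>I. g i (x i)) =
           (\<Prod>i\<in>I. measure_pmf.expectation (bernoulli_pmf p) (g i))"
  using assms
proof (induction I rule: finite_induct)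
  case empty
  show ?case by (simp add: cube_pmf_def)
next
  case (insert a I)
  have fin: "finite (set_pmf (Pi_pmf I False (\<lambda>_. bernoulli_pmf p)))"
    using insert by (simp add: set_Pi_pmf finite_PiE_dflt)
  have "cube_expectation p (insert a I) (\<lambda>x. \<Prod>i\<in>insert a I. g i (x i)) =
          measure_pmf.expectation
            (pair_pmf (bernoulli_pmf p) (Pi_pmf I False (\<lambda>_. bernoulli_pmf p)))
            (\<lambda>(b, x). g a b * (\<Prod>i\<in>I. g i (x i)))"
    unfolding cube_pmf_def using insert
    by (subst Pi_pmf_insert)
       (auto simp: case_prod_unfold intro!: Bochner_Integration.integral_cong prod.cong)
  also have "\<dots> = measure_pmf.expectation (bernoulli_pmf p) (g a) *
                   measure_pmf.expectation (Pi_pmf I False (\<lambda>_. bernoulli_pmf p))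
                     (\<lambda>x. \<Prod>i\<in>I. g i (x i))"
  proof -
    let ?P = "Pi_pmf I False (\<lambda>_. bernoulli_pmf p)"
    have "measure_pmf.expectation (pair_pmf (bernoulli_pmf p) ?P) (\<lambda>(b, x). g a b * (\<Prod>i\<in>I. g i (x i))) =
            (\<Sum>z\<in>UNIV \<times> set_pmf ?P. (case z of (b, x) \<Rightarrow> g a b * (\<Prod>i\<in>I. g i (x i))) *
               pmf (pair_pmf (bernoulli_pmf p) ?P) z)"
      using fin by (intro integral_measure_pmf_real) auto
    also have "\<dots> = (\<Sum>b\<in>UNIV. g a b * pmf (bernoulli_pmf p) b) *
                     (\<Sum>x\<in>set_pmf ?P. (\<Prod>i\<in>I. g i (x i)) * pmf ?P x)"
      unfolding sum_product sum.cartesian_product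
      by (intro sum.cong refl) (auto simp: pmf_pair)
    also have "(\<Sum>b\<in>UNIV. g a b * pmf (bernoulli_pmf p) b) =
                 measure_pmf.expectation (bernoulli_pmf p) (g a)"
      by (rule integral_measure_pmf_real[symmetric]) auto
    also have "(\<Sum>x\<in>set_pmf ?P. (\<Prod>i\<in>I. g i (x i)) * pmf ?P x) =
                 measure_pmf.expectation ?P (\<lambda>x. \<Prod>i\<in>I. g i (x i))"
      using fin by (intro integral_measure_pmf_real[symmetric]) auto
    finally show ?thesis .
  qed
  finally show ?case using insert by (simp add: cube_pmf_def)
qed

lemma chi_orthonormal:
  assumes "0 < p" "p < 1" "finite I" "S \<subseteq> I" "T \<subseteq> I"
  shows "cube_expectation p I (\<lambda>x. chi p S x * chi p T x) = of_bool (S = T)"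
proof -
  define g where "g i b = (if i \<in> S then chi1 p b else 1) * (if i \<in> T then chi1 p b else 1)"
    for i b
  have s: "std_dev p * std_dev p = p * (1 - p)" "std_dev p \<noteq> 0"
    using assms by (auto simp: std_dev_def)
  have "chi p S x * chi p T x = (\<Prod>i\<in>I. g i (x i))" for x
    using assms(3-5) unfolding g_def chi_def
    by (simp add: prod.distrib prod.If_cases Int_absorb1)
  moreover have "measure_pmf.expectation (bernoulli_pmf p) (g i) = of_bool (i \<in> S \<longleftrightarrow> i \<in> T)" for i
  proof -
    have "(1 - p) * (1 - p) * p + p * p * (1 - p) = p * (1 - p)"
      by (simp add: algebra_simps)
    then have "(1 - p) / std_dev p * ((1 - p) / std_dev p) * p +
                 (- p / std_dev p) * (- p / std_dev p) * (1 - p) = 1"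
      using assms(1,2) by (simp add: s flip: add_divide_distrib)
    moreover have "(1 - p) / std_dev p * p + (- p / std_dev p) * (1 - p) = 0"
      using s by (simp add: field_simps)
    ultimately show ?thesis
      using assms(1,2) by (cases "i \<in> S"; cases "i \<in> T") (simp_all add: g_def chi1_def)
  qed
  ultimately have "cube_expectation p I (\<lambda>x. chi p S x * chi p T x) =
                     (\<Prod>i\<in>I. of_bool (i \<in> S \<longleftrightarrow> i \<in> T))"
    using assms(3) by (simp add: expectation_prod_cube)
  also have "\<dots> = of_bool (S = T)"
    using assms(3-5) by (auto intro!: prod_zero simp: of_bool_def split: if_splits)
  finally show ?thesis .
qed

lemma fourier_expansion:
  assumes p: "0 < p" "p < 1" and I: "finite I" and x: "\<And>i. i \<notin> I \<Longrightarrow> \<not> x i"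
  shows "f x = (\<Sum>S\<in>Pow I. fourier_coeff p I f S * chi p S x)"
proof -
  have s: "std_dev p * std_dev p = p * (1 - p)" "std_dev p \<noteq> 0"
    using p by (auto simp: std_dev_def)
  let ?C = "PiE_dflt I False (\<lambda>_. UNIV :: bool set)"
  have C: "finite ?C" "x \<in> ?C" using I x by (simp add: finite_PiE_dflt, simp add: PiE_dflt_def)
  have E: "cube_expectation p I h = (\<Sum>y\<in>?C. h y * pmf (cube_pmf p I) y)" for h
    using I C(1) p unfolding cube_pmf_def
    by (intro integral_measure_pmf_real) (auto simp: set_Pi_pmf PiE_dflt_def)
  have kern: "pmf (cube_pmf p I) y * (\<Sum>S\<in>Pow I. chi p S y * chi p S x) = of_bool (y = x)"
    if y: "y \<in> ?C" for y
  proof -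
    have 1: "(\<Sum>S\<in>Pow I. chi p S y * chi p S x) = (\<Prod>i\<in>I. chi1 p (y i) * chi1 p (x i) + 1)"
      using I by (simp add: prod_add chi_def prod.distrib)
    have 2: "pmf (cube_pmf p I) y = (\<Prod>i\<in>I. pmf (bernoulli_pmf p) (y i))"
      using I y unfolding cube_pmf_def by (subst pmf_Pi') (auto simp: PiE_dflt_def)
    have "pmf (cube_pmf p I) y * (\<Sum>S\<in>Pow I. chi p S y * chi p S x) =
            (\<Prod>i\<in>I. pmf (bernoulli_pmf p) (y i) * (chi1 p (y i) * chi1 p (x i) + 1))"
      by (simp add: 1 2 prod.distrib)
    also have "\<dots> = (\<Prod>i\<in>I. of_bool (y i = x i))"
    proof (rule prod.cong[OF refl])
      fix i
      show "pmf (bernoulli_pmf p) (y i) * (chi1 p (y i) * chi1 p (x i) + 1) = of_bool (y i = x i)"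
        using p s by (cases "y i"; cases "x i") (simp_all add: chi1_def field_simps)
    qed
    also have "\<dots> = of_bool (y = x)"
      using I y x by (auto simp: of_bool_def PiE_dflt_def fun_eq_iff prod_zero_iff)
    finally show ?thesis .
  qed
  have "(\<Sum>S\<in>Pow I. fourier_coeff p I f S * chi p S x) =
          (\<Sum>y\<in>?C. f y * (pmf (cube_pmf p I) y * (\<Sum>S\<in>Pow I. chi p S y * chi p S x)))"
    unfolding fourier_coeff_def E sum_distrib_right sum_distrib_left
    by (subst sum.swap) (simp add: mult_ac)
  also have "\<dots> = (\<Sum>y\<in>?C. f y * of_bool (y = x))"
    by (intro sum.cong refl) (simp only: kern)
  also have "\<dots> = f x"
    using C by (simp add: of_bool_def if_distrib cong: if_cong)
  finally show ?thesis ..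
qed

lemma noise_op_chi:
  assumes "0 < p" "p < 1" "finite I" "S \<subseteq> I"
  shows "noise_op p I \<rho> (chi p S) x = \<rho> ^ card S * chi p S x"
proof -
  have "noise_op p I \<rho> (chi p S) x =
          (\<Sum>T\<in>Pow I. if T = S then \<rho> ^ card S * chi p S x else 0)"
    unfolding noise_op_def fourier_coeff_def using assms
    by (intro sum.cong refl) (auto simp: chi_orthonormal)
  then show ?thesis using assms by simp
qed

end

theory Submission
  imports Defs
begin

text \<open>
  The \<open>\<beta>\<close>-free estimate behind the theorem is
  \<open>E[(T\<^bsub>1/2\<^esub> f)\<^sup>2 (T\<^bsub>1/2\<^esub> g)\<^sup>2] \<le> (\<Sum>S. \<lambda>^|S| \<parallel>D\<^sub>S f\<parallel>\<^sup>2 \<parallel>D\<^sub>S g\<parallel>\<^sup>2)\<close>,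
  proved by induction on the number of coordinates.  Having two functions is essential: for \<open>f = g\<close>
  alone the cross terms of the induction step would have to be estimated by Cauchy--Schwarz, which
  loses too much, whereas in the bilinear form they are again instances of the induction hypothesis.
  For the theorem, write \<open>T\<^bsub>1/\<surd>24\<^esub> = T\<^bsub>1/2\<^esub> T\<^bsub>1/\<surd>6\<^esub>\<close>, take \<open>f = g\<close>,
  use the hypothesis for one of the two factors \<open>\<parallel>D\<^sub>S f\<parallel>\<^sup>2\<close>, and absorb the sum over
  \<open>S\<close> of the other ones, in which the coefficient at \<open>T\<close> is counted \<open>2^|T|\<close> times, into
  \<open>T\<^bsub>1/\<surd>6\<^esub>\<close>.
\<close>

section \<open>Fourier sums given by their coefficients, and splitting off one coordinate\<close>

definition fourier_sum :: "real \<Rightarrow> 'i set \<Rightarrow> ('i set \<Rightarrow> real) \<Rightarrow> ('i \<Rightarrow> bool) \<Rightarrow> real" where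
  "fourier_sum p I a x = (\<Sum>S\<in>Pow I. a S * chi p S x)"

text \<open>When \<open>a\<close> is the Fourier coefficient family of f, this is the squared 2-norm
  of the derivative of f along \<open>S\<close>; see \<open>expectation_deriv_op_square\<close>.
  Stated for coefficients, it stays meaningful for the restricted families met in the
  induction.\<close>

definition upper_weight :: "'i set \<Rightarrow> ('i set \<Rightarrow> real) \<Rightarrow> 'i set \<Rightarrow> real" where
  "upper_weight I a S = (\<Sum>T | S \<subseteq> T \<and> T \<subseteq> I. (a T)\<^sup>2)"

lemma finite_set_cube_pmf:
  assumes "finite I"
  shows "finite (set_pmf (cube_pmf p I))"
  unfolding cube_pmf_def using assms by (simp add: set_Pi_pmf finite_PiE_dflt)

lemma integrable_cube_pmf [simp]:
  fixes h :: "('i \<Rightarrow> bool) \<Rightarrow> real"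
  assumes "finite I"
  shows "integrable (measure_pmf (cube_pmf p I)) h"
  using finite_set_cube_pmf[OF assms] by (rule integrable_measure_pmf_finite)

lemma sum_Pow_insert:
  assumes "finite J" "i \<notin> J"
  shows "(\<Sum>S\<in>Pow (insert i J). g S) = (\<Sum>S\<in>Pow J. g S + g (insert i S))"
proof -
  have "inj_on (insert i) (Pow J)" "Pow J \<inter> insert i ` Pow J = {}"
    using assms(2) by (auto simp: inj_on_def)
  then show ?thesis
    using assms(1) by (simp add: Pow_insert sum.union_disjoint sum.reindex sum.distrib)
qed

lemma cube_expectation_insert:
  fixes h :: "('i \<Rightarrow> bool) \<Rightarrow> real"
  assumes "0 < p" "p < 1" "finite J" "i \<notin> J"
  shows "cube_expectation p (insert i J) h =
           cube_expectation p J (\<lambda>x. p * h (x(i := True)) + (1 - p) * h (x(i := False)))"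
proof -
  have "cube_pmf p (insert i J) =
          bind_pmf (bernoulli_pmf p) (\<lambda>b. map_pmf (\<lambda>x. x(i := b)) (cube_pmf p J))"
    unfolding cube_pmf_def using assms(3,4)
    by (subst Pi_pmf_insert') (auto simp: map_pmf_def)
  then show ?thesis
    using assms
    by (simp add: pmf_expectation_bind[where A = UNIV] finite_set_cube_pmf UNIV_bool algebra_simps)
qed

lemma chi_upd:
  assumes "i \<notin> S"
  shows "chi p S (x(i := b)) = chi p S x"
  unfolding chi_def using assms by (intro prod.cong) auto

lemma chi_insert:
  assumes "finite S" "i \<notin> S"
  shows "chi p (insert i S) x = chi1 p (x i) * chi p S x"
  unfolding chi_def using assms by simp

text \<open>Grouping the characters by whether they contain \<open>i\<close> writes f as g + chi_i
  h, where h is the derivative in direction \<open>i\<close> and neither g nor h depends on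
  coordinate \<open>i\<close>. Both are Fourier sums over \<open>J\<close>, so an induction over
  index sets can continue with their coefficient families.\<close>

lemma fourier_sum_insert:
  assumes "finite J" "i \<notin> J"
  shows "fourier_sum p (insert i J) a (x(i := b)) =
           fourier_sum p J a x + chi1 p b * fourier_sum p J (\<lambda>S. a (insert i S)) x"
proof -
  have "chi p S (x(i := b)) = chi p S x"
       "chi p (insert i S) (x(i := b)) = chi1 p b * chi p S x" if "S \<in> Pow J" for S
  proof -
    have "finite S" "i \<notin> S" using that assms finite_subset by auto
    then show "chi p S (x(i := b)) = chi p S x"
      "chi p (insert i S) (x(i := b)) = chi1 p b * chi p S x"
      by (simp_all add: chi_insert chi_upd)
  qed
  then show ?thesis
    using assms
    by (simp add: fourier_sum_def sum_Pow_insert sum.distrib sum_distrib_left mult_ac)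
qed

lemma upper_weight_nonneg [simp]: "0 \<le> upper_weight I a S"
  unfolding upper_weight_def by (simp add: sum_nonneg)

text \<open>Moving the condition \<open>S \<subseteq> T\<close> into the summand makes the index
  range independent of \<open>S\<close>, as needed for \<open>sum_Pow_insert\<close> and for
  exchanging sums.\<close>

lemma upper_weight_conv_Pow:
  assumes "finite I"
  shows "upper_weight I a S = (\<Sum>T\<in>Pow I. if S \<subseteq> T then (a T)\<^sup>2 else 0)"
proof -
  have "{T. S \<subseteq> T \<and> T \<subseteq> I} = Pow I \<inter> {T. S \<subseteq> T}" by auto
  then show ?thesis
    using assms by (simp add: upper_weight_def sum.inter_restrict)
qed

lemma upper_weight_insert:
  assumes "finite J" "i \<notin> J" "S \<subseteq> J"
  shows "upper_weight (insert i J) a S =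
           upper_weight J a S + upper_weight J (\<lambda>T. a (insert i T)) S"
    and "upper_weight (insert i J) a (insert i S) = upper_weight J (\<lambda>T. a (insert i T)) S"
proof -
  have *: "S \<subseteq> insert i T \<longleftrightarrow> S \<subseteq> T" "\<not> insert i S \<subseteq> T" "insert i S \<subseteq> insert i T \<longleftrightarrow> S \<subseteq> T"
    if "T \<in> Pow J" for T
    using that assms by auto
  show "upper_weight (insert i J) a S =
           upper_weight J a S + upper_weight J (\<lambda>T. a (insert i T)) S"
    unfolding upper_weight_conv_Pow[OF assms(1)] upper_weight_conv_Pow[OF finite.insertI[OF assms(1)]]
      sum_Pow_insert[OF assms(1,2)] sum.distrib
    by (intro arg_cong2[where f = "(+)"] sum.cong refl) (simp_all only: *)
  show "upper_weight (insert i J) a (insert i S) = upper_weight J (\<lambda>T. a (insert i T)) S"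
    unfolding upper_weight_conv_Pow[OF assms(1)] upper_weight_conv_Pow[OF finite.insertI[OF assms(1)]]
      sum_Pow_insert[OF assms(1,2)]
    by (intro sum.cong refl) (simp add: * del: insert_subset)
qed

text \<open>Double counting: after exchanging the sums, each \<open>T\<close> contributes once for
  every one of its subsets \<open>S\<close>.\<close>

lemma sum_upper_weight:
  assumes "finite I"
  shows "(\<Sum>S\<in>Pow I. upper_weight I a S) = (\<Sum>T\<in>Pow I. 2 ^ card T * (a T)\<^sup>2)"
proof -
  have "(\<Sum>S\<in>Pow I. upper_weight I a S) = (\<Sum>T\<in>Pow I. (\<Sum>S\<in>Pow I. of_bool (S \<subseteq> T)) * (a T)\<^sup>2)"
    unfolding upper_weight_conv_Pow[OF assms] sum_distrib_right
    by (subst sum.swap) (intro sum.cong refl, simp)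
  also have "\<dots> = (\<Sum>T\<in>Pow I. 2 ^ card T * (a T)\<^sup>2)"
  proof (intro sum.cong refl)
    fix T assume "T \<in> Pow I"
    then have "Pow I \<inter> {S. S \<subseteq> T} = Pow T" "finite T" using assms finite_subset by auto
    then show "(\<Sum>S\<in>Pow I. of_bool (S \<subseteq> T)) * (a T)\<^sup>2 = 2 ^ card T * (a T)\<^sup>2"
      using assms by (simp add: sum_of_bool_eq card_Pow)
  qed
  finally show ?thesis .
qed

section \<open>Moments of a single coordinate and the two-point inequality\<close>

lemma chi1_moments:
  assumes "0 < p" "p < 1"
  shows "p * chi1 p True + (1 - p) * chi1 p False = 0"
    and "p * chi1 p True ^ 2 + (1 - p) * chi1 p False ^ 2 = 1"
    and "p * chi1 p True ^ 4 + (1 - p) * chi1 p False ^ 4 = fourth_moment p"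
    and "(p * chi1 p True ^ 3 + (1 - p) * chi1 p False ^ 3)\<^sup>2 \<le> fourth_moment p"
proof -
  have s: "(std_dev p)\<^sup>2 = p * (1 - p)" "std_dev p > 0"
    using assms by (auto simp: std_dev_def)
  show "p * chi1 p True + (1 - p) * chi1 p False = 0"
    using s by (simp add: chi1_def field_simps)
  have "p * chi1 p True ^ 2 + (1 - p) * chi1 p False ^ 2 =
          (p * (1 - p)^2 + (1 - p) * p^2) / (std_dev p)\<^sup>2"
    by (simp add: chi1_def power_divide add_divide_distrib)
  also have "p * (1 - p)^2 + (1 - p) * p^2 = p * (1 - p)"
    by (simp add: power2_eq_square algebra_simps)
  finally show "p * chi1 p True ^ 2 + (1 - p) * chi1 p False ^ 2 = 1"
    using s assms by simp
  show "p * chi1 p True ^ 4 + (1 - p) * chi1 p False ^ 4 = fourth_moment p"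
    using assms by (simp add: fourth_moment_def mult.commute)
  have "p * chi1 p True ^ 3 + (1 - p) * chi1 p False ^ 3 =
          (p * (1 - p)^3 + (1 - p) * (- p)^3) / std_dev p ^ 3"
    by (simp add: chi1_def power_divide) (rule diff_divide_distrib[symmetric])
  also have "p * (1 - p)^3 + (1 - p) * (- p)^3 = (1 - 2 * p) * (std_dev p)\<^sup>2"
    unfolding s by (simp add: power2_eq_square power3_eq_cube algebra_simps)
  also have "\<dots> / std_dev p ^ 3 = (1 - 2 * p) / std_dev p"
    using s(2) by (simp add: power2_eq_square power3_eq_cube)
  finally have "(p * chi1 p True ^ 3 + (1 - p) * chi1 p False ^ 3)\<^sup>2 = (1 - 2 * p)\<^sup>2 / (std_dev p)\<^sup>2"
    by (simp add: power_divide)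
  \<comment> \<open>Both sides equal 1 - 4p(1 - p). Hence the squared third moment is exactly
    \<lambda> - 1.\<close>
  also have "(1 - 2 * p)\<^sup>2 = (1 - p)^3 + p^3 - p * (1 - p)"
    by (simp add: power2_eq_square power3_eq_cube algebra_simps)
  also have "\<dots> / (std_dev p)\<^sup>2 \<le> ((1 - p)^3 + p^3) / (std_dev p)\<^sup>2"
    using assms by (intro divide_right_mono) auto
  finally show "(p * chi1 p True ^ 3 + (1 - p) * chi1 p False ^ 3)\<^sup>2 \<le> fourth_moment p"
    using assms by (simp add: fourth_moment_eq)
qed

lemma fourth_moment_pos:
  assumes "0 < p" "p < 1"
  shows "0 < fourth_moment p"
  using assms by (simp add: fourth_moment_eq std_dev_def add_pos_pos)

text \<open>The one-coordinate case with noise rate 1/2: \<open>u\<close>, \<open>w\<close> are the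
  parts free of the coordinate, \<open>v\<close>, \<open>z\<close> the derivatives. The noise makes
  the cross terms small enough to fit, with coefficient exactly 1, into
  \<open>u\<^sup>2 * z\<^sup>2 + v\<^sup>2 * w\<^sup>2\<close>.\<close>

lemma two_point_bilinear:
  assumes p: "0 < p" "p < 1"
  shows "p * ((u + chi1 p True * (v / 2))\<^sup>2 * (w + chi1 p True * (z / 2))\<^sup>2) +
         (1 - p) * ((u + chi1 p False * (v / 2))\<^sup>2 * (w + chi1 p False * (z / 2))\<^sup>2)
           \<le> u\<^sup>2 * w\<^sup>2 + u\<^sup>2 * z\<^sup>2 + v\<^sup>2 * w\<^sup>2 + fourth_moment p * (v\<^sup>2 * z\<^sup>2)"
proof -
  define m3 where "m3 = p * chi1 p True ^ 3 + (1 - p) * chi1 p False ^ 3"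
  \<comment> \<open>Up to the noise factors, \<open>q\<close> and \<open>e\<close> are the linear
    and quadratic coefficients of the product before squaring: uw + c q/2 + c^2 e/4.\<close>
  define q where "q = u * z + v * w"
  define e where "e = v * z"
  have expand: "(u + c * (v / 2))\<^sup>2 * (w + c * (z / 2))\<^sup>2 =
      u\<^sup>2 * w\<^sup>2 + c * (u * w * q) + c^2 * ((q\<^sup>2 + 2 * (u * w * e)) / 4)
        + c^3 * (q * e / 4) + c^4 * (e\<^sup>2 / 16)" for c
    unfolding q_def e_def
    by (simp add: power2_eq_square power3_eq_cube power4_eq_xxxx field_simps)
  have average: "p * (k0 + s * k1 + s^2 * k2 + s^3 * k3 + s^4 * k4)
        + (1 - p) * (k0 + t * k1 + t^2 * k2 + t^3 * k3 + t^4 * k4) =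
      k0 + (p * s + (1 - p) * t) * k1 + (p * s^2 + (1 - p) * t^2) * k2
        + (p * s^3 + (1 - p) * t^3) * k3 + (p * s^4 + (1 - p) * t^4) * k4"
    for s t k0 k1 k2 k3 k4
    by (simp add: algebra_simps)
  have "p * ((u + chi1 p True * (v / 2))\<^sup>2 * (w + chi1 p True * (z / 2))\<^sup>2) +
         (1 - p) * ((u + chi1 p False * (v / 2))\<^sup>2 * (w + chi1 p False * (z / 2))\<^sup>2) =
        u\<^sup>2 * w\<^sup>2 + (p * chi1 p True + (1 - p) * chi1 p False) * (u * w * q)
         + (p * chi1 p True ^ 2 + (1 - p) * chi1 p False ^ 2) * ((q\<^sup>2 + 2 * (u * w * e)) / 4)
         + m3 * (q * e / 4)
         + (p * chi1 p True ^ 4 + (1 - p) * chi1 p False ^ 4) * (e\<^sup>2 / 16)"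
    unfolding expand m3_def by (rule average)
  also have "\<dots> = u\<^sup>2 * w\<^sup>2 + (q\<^sup>2 + 2 * (u * w * e)) / 4 + m3 * (q * e / 4)
                    + fourth_moment p * (e\<^sup>2 / 16)"
    using chi1_moments(1-3)[OF p] by simp
  also have "\<dots> \<le> u\<^sup>2 * w\<^sup>2 + u\<^sup>2 * z\<^sup>2 + v\<^sup>2 * w\<^sup>2 + fourth_moment p * e\<^sup>2"
  proof -
    \<comment> \<open>Put A = \<open>u\<^sup>2 * z\<^sup>2 + v\<^sup>2 * w\<^sup>2\<close>. AM-GM on
      \<open>q\<close> and \<open>m3 * e\<close> turns the third-moment term into q^2/8 + \<lambda>
      e^2/8, so q^2 has total coefficient 3/8. As q^2 \<le> 2A and 2uwe \<le> A, the cross terms sum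
      to at most 3A/4 + A/4 = A, while e^2 gets only 3\<lambda>/16.\<close>
    have "(m3 * e)\<^sup>2 \<le> fourth_moment p * e\<^sup>2"
      using chi1_moments(4)[OF p] unfolding m3_def by (simp add: power_mult_distrib mult_right_mono)
    moreover have "2 * (q * (m3 * e)) \<le> q\<^sup>2 + (m3 * e)\<^sup>2"
      using sum_squares_bound[of q "m3 * e"] by simp
    moreover have "2 * (u * w * e) \<le> u\<^sup>2 * z\<^sup>2 + v\<^sup>2 * w\<^sup>2"
      using sum_squares_bound[of "u * z" "v * w"]
      by (simp add: e_def power_mult_distrib mult_ac)
    moreover have "q\<^sup>2 = u\<^sup>2 * z\<^sup>2 + v\<^sup>2 * w\<^sup>2 + 2 * (u * w * e)"
      unfolding q_def e_def by algebra
    moreover have "0 \<le> fourth_moment p * e\<^sup>2" "m3 * (q * e / 4) = (q * (m3 * e)) / 4"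
      using fourth_moment_pos[OF p] by auto
    ultimately show ?thesis by (simp add: field_simps)
  qed
  finally show ?thesis by (simp add: e_def power_mult_distrib)
qed

section \<open>The bilinear estimate, by induction on the coordinates\<close>

lemma bilinear_hypercontractivity:
  fixes a b :: "'i set \<Rightarrow> real"
  assumes p: "0 < p" "p < 1" and "finite I"
  shows "cube_expectation p I (\<lambda>x. (fourier_sum p I (\<lambda>S. (1/2) ^ card S * a S) x)\<^sup>2 *
                                   (fourier_sum p I (\<lambda>S. (1/2) ^ card S * b S) x)\<^sup>2)
           \<le> (\<Sum>S\<in>Pow I. fourth_moment p ^ card S * (upper_weight I a S * upper_weight I b S))"
  using assms(3)
proof (induction I arbitrary: a b rule: finite_induct)
  case empty
  have "{T. T = {}} = {{} :: 'i set}" by auto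
  then show ?case by (simp add: fourier_sum_def upper_weight_def chi_def cube_pmf_def)
next
  case (insert i J)
  let ?E = "cube_expectation p J" and ?l = "fourth_moment p"
  let ?F = "\<lambda>a. fourier_sum p J (\<lambda>S. (1/2) ^ card S * a S)"
  let ?W = "upper_weight J"
  let ?R = "\<lambda>a b. \<Sum>S\<in>Pow J. ?l ^ card S * (?W a S * ?W b S)"
  let ?a' = "\<lambda>S. a (insert i S)" and ?b' = "\<lambda>S. b (insert i S)"
  have card: "card (insert i S) = Suc (card S)" if "S \<in> Pow J" for S
    using that insert.hyps finite_subset[of S J] by (subst card_insert_disjoint) auto
  \<comment> \<open>Sets containing \<open>i\<close> have one more element than their trace on
    \<open>J\<close>, so the derivative part carries an extra factor 1/2. This is the shape required
    by \<open>two_point_bilinear\<close>.\<close>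
  have split: "fourier_sum p (insert i J) (\<lambda>S. (1/2) ^ card S * c S) (x(i := t)) =
                 ?F c x + chi1 p t * (?F (\<lambda>S. c (insert i S)) x / 2)" for c x t
  proof -
    have "fourier_sum p J (\<lambda>S. (1/2) ^ card (insert i S) * c (insert i S)) x =
            ?F (\<lambda>S. c (insert i S)) x / 2"
      unfolding fourier_sum_def sum_divide_distrib
      by (intro sum.cong refl) (simp add: card)
    then show ?thesis by (simp only: fourier_sum_insert[OF insert.hyps])
  qed
  have "cube_expectation p (insert i J)
          (\<lambda>x. (fourier_sum p (insert i J) (\<lambda>S. (1/2) ^ card S * a S) x)\<^sup>2 *
               (fourier_sum p (insert i J) (\<lambda>S. (1/2) ^ card S * b S) x)\<^sup>2)
        \<le> ?E (\<lambda>x. (?F a x)\<^sup>2 * (?F b x)\<^sup>2 + (?F a x)\<^sup>2 * (?F ?b' x)\<^sup>2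
             + (?F ?a' x)\<^sup>2 * (?F b x)\<^sup>2 + ?l * ((?F ?a' x)\<^sup>2 * (?F ?b' x)\<^sup>2))"
    unfolding cube_expectation_insert[OF p insert.hyps] split
    using insert.hyps by (intro integral_mono two_point_bilinear p) simp_all
  also have "\<dots> = ?E (\<lambda>x. (?F a x)\<^sup>2 * (?F b x)\<^sup>2) + ?E (\<lambda>x. (?F a x)\<^sup>2 * (?F ?b' x)\<^sup>2)
      + ?E (\<lambda>x. (?F ?a' x)\<^sup>2 * (?F b x)\<^sup>2) + ?l * ?E (\<lambda>x. (?F ?a' x)\<^sup>2 * (?F ?b' x)\<^sup>2)"
    using insert.hyps by simp
  \<comment> \<open>The induction hypothesis is used for four pairs, each formed from
    \<open>a\<close> or \<open>?a'\<close> and \<open>b\<close> or \<open>?b'\<close>; hence the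
    generalization over both families.\<close>
  also have "\<dots> \<le> ?R a b + ?R a ?b' + ?R ?a' b + ?l * ?R ?a' ?b'"
    using fourth_moment_pos[OF p]
    by (intro add_mono mult_left_mono insert.IH) simp_all
  also have "\<dots> = (\<Sum>S\<in>Pow J. ?l ^ card S * (?W a S * ?W b S + ?W a S * ?W ?b' S
                      + ?W ?a' S * ?W b S + ?l * (?W ?a' S * ?W ?b' S)))"
    by (simp add: sum.distrib sum_distrib_left algebra_simps)
  \<comment> \<open>Adding the nonnegative term \<open>?W ?a' S * ?W ?b' S\<close> completes the
    product of the upper weights at \<open>S\<close> over \<open>insert i J\<close>. The summand
    with the extra \<open>?l\<close> belongs to \<open>insert i S\<close>.\<close>
  also have "\<dots> \<le> (\<Sum>S\<in>Pow J. ?l ^ card S * ((?W a S + ?W ?a' S) * (?W b S + ?W ?b' S)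
                      + ?l * (?W ?a' S * ?W ?b' S)))"
    using fourth_moment_pos[OF p]
    by (intro sum_mono mult_left_mono) (simp_all add: algebra_simps)
  also have "\<dots> = (\<Sum>S\<in>Pow (insert i J). ?l ^ card S *
                     (upper_weight (insert i J) a S * upper_weight (insert i J) b S))"
    unfolding sum_Pow_insert[OF insert.hyps]
    by (intro sum.cong refl) (simp add: card upper_weight_insert insert.hyps algebra_simps)
  finally show ?case .
qed

section \<open>Parseval identities and the 2- and 4-norms\<close>

lemma parseval:
  assumes p: "0 < p" "p < 1" and "finite I" and g: "inj_on g A" "g ` A \<subseteq> Pow I"
  shows "cube_expectation p I (\<lambda>x. (\<Sum>T\<in>A. c T * chi p (g T) x)\<^sup>2) = (\<Sum>T\<in>A. (c T)\<^sup>2)"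
proof -
  have A: "finite A"
    using assms(3) g by (meson finite_Pow_iff inj_on_finite)
  have "cube_expectation p I (\<lambda>x. (\<Sum>T\<in>A. c T * chi p (g T) x)\<^sup>2) =
          cube_expectation p I (\<lambda>x. \<Sum>T\<in>A. \<Sum>U\<in>A. c T * c U * (chi p (g T) x * chi p (g U) x))"
    by (simp add: power2_eq_square sum_product mult_ac)
  also have "\<dots> = (\<Sum>T\<in>A. \<Sum>U\<in>A. c T * c U * of_bool (g T = g U))"
    using assms by (simp add: chi_orthonormal image_subset_iff)
  also have "\<dots> = (\<Sum>T\<in>A. \<Sum>U\<in>A. if T = U then (c T)\<^sup>2 else 0)"
    using g(1) by (intro sum.cong refl) (auto simp: inj_on_def power2_eq_square)
  also have "\<dots> = (\<Sum>T\<in>A. (c T)\<^sup>2)"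
    using A by simp
  finally show ?thesis .
qed

lemma expectation_deriv_op_square:
  assumes "0 < p" "p < 1" "finite I" "S \<subseteq> I"
  shows "cube_expectation p I (\<lambda>x. (deriv_op p I S f x)\<^sup>2) = upper_weight I (fourier_coeff p I f) S"
proof -
  \<comment> \<open>Removing \<open>S\<close> from its supersets keeps them distinct, so the
    characters in the derivative are still orthonormal. The relabelling \<open>g\<close> in
    \<open>parseval\<close> serves this case.\<close>
  have "inj_on (\<lambda>T. T - S) {T. S \<subseteq> T \<and> T \<subseteq> I}" "(\<lambda>T. T - S) ` {T. S \<subseteq> T \<and> T \<subseteq> I} \<subseteq> Pow I"
    by (auto simp: inj_on_def)
  then show ?thesis
    unfolding deriv_op_def upper_weight_def using assms(1-3) by (subst parseval) auto
qed

lemma expectation_square: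
  assumes "0 < p" "p < 1" "finite I"
  shows "cube_expectation p I (\<lambda>x. (f x)\<^sup>2) = (\<Sum>T\<in>Pow I. (fourier_coeff p I f T)\<^sup>2)"
proof -
  have "f x = fourier_sum p I (fourier_coeff p I f) x" if "x \<in> set_pmf (cube_pmf p I)" for x
  proof -
    have "\<not> x i" if "i \<notin> I" for i
      using that \<open>x \<in> set_pmf (cube_pmf p I)\<close> assms(3)
      by (auto simp: cube_pmf_def set_Pi_pmf PiE_dflt_def)
    then show ?thesis
      unfolding fourier_sum_def using assms by (rule_tac fourier_expansion)
  qed
  \<comment> \<open>The expansion of f holds only at points that are \<open>False\<close> outside
    \<open>I\<close>, so the integrands agree almost everywhere rather than everywhere.\<close>
  then have "cube_expectation p I (\<lambda>x. (f x)\<^sup>2) =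
        cube_expectation p I (\<lambda>x. (fourier_sum p I (fourier_coeff p I f) x)\<^sup>2)"
    by (intro integral_cong_AE) (auto simp: AE_measure_pmf_iff)
  also have "\<dots> = (\<Sum>T\<in>Pow I. (fourier_coeff p I f T)\<^sup>2)"
    unfolding fourier_sum_def using assms by (subst parseval[where g = "\<lambda>T. T"]) auto
  finally show ?thesis .
qed

lemma cube_norm_2_squared:
  "(cube_norm p I 2 f)\<^sup>2 = cube_expectation p I (\<lambda>x. (f x)\<^sup>2)"
proof -
  have "\<bar>f x\<bar> powr 2 = (f x)\<^sup>2" for x
    by (cases "f x = 0") (auto simp: powr_numeral)
  moreover have "0 \<le> cube_expectation p I (\<lambda>x. (f x)\<^sup>2)" by simp
  ultimately show ?thesis by (simp add: cube_norm_def powr_half_sqrt)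
qed

lemma cube_norm_4:
  "cube_norm p I 4 f = cube_expectation p I (\<lambda>x. (f x) ^ 4) powr (1 / 4)"
proof -
  have "\<bar>f x\<bar> powr 4 = (f x) ^ 4" for x
    by (cases "f x = 0") (auto simp: powr_numeral)
  then show ?thesis by (simp add: cube_norm_def)
qed

section \<open>The fourth moment under noise, and the norm inequality\<close>

lemma noise_op_fourth_moment_bound:
  fixes f :: "('i \<Rightarrow> bool) \<Rightarrow> real"
  assumes p: "0 < p" "p < 1" and I: "finite I" and "0 \<le> \<beta>"
    and r: "2 * r\<^sup>2 \<le> 1"
    and global: "\<And>S. S \<subseteq> I \<Longrightarrow> upper_weight I (fourier_coeff p I f) S
        \<le> \<beta> * fourth_moment p powi (- int (card S)) * cube_expectation p I (\<lambda>x. (f x)\<^sup>2)"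
  shows "cube_expectation p I (\<lambda>x. noise_op p I (r / 2) f x ^ 4)
           \<le> \<beta> * (cube_expectation p I (\<lambda>x. (f x)\<^sup>2))\<^sup>2"
proof -
  define c where "c = fourier_coeff p I f"
  \<comment> \<open>These are the coefficients after noise \<open>r\<close>; the remaining noise 1/2
    is the one built into the bilinear estimate.\<close>
  define a where "a S = r ^ card S * c S" for S
  let ?l = "fourth_moment p" and ?e = "cube_expectation p I (\<lambda>x. (f x)\<^sup>2)"
  have l: "?l > 0" using p by (rule fourth_moment_pos)
  have e: "0 \<le> ?e" by simp
  have sq: "(a T)\<^sup>2 = (r\<^sup>2) ^ card T * (c T)\<^sup>2" for T
    by (simp add: a_def power_mult_distrib power_mult[symmetric] mult.commute)
  have a_le: "(a T)\<^sup>2 \<le> (c T)\<^sup>2" for T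
  proof -
    have "(r\<^sup>2) ^ card T \<le> 1" using r by (intro power_le_one[of "r\<^sup>2"]) auto
    then show ?thesis unfolding sq by (intro mult_left_le_one_le) auto
  qed
  have "noise_op p I (r / 2) f x = fourier_sum p I (\<lambda>S. (1/2) ^ card S * a S) x" for x
    unfolding noise_op_def fourier_sum_def a_def c_def
    by (simp add: power_divide mult_ac)
  then have "cube_expectation p I (\<lambda>x. noise_op p I (r / 2) f x ^ 4) =
      cube_expectation p I (\<lambda>x. (fourier_sum p I (\<lambda>S. (1/2) ^ card S * a S) x)\<^sup>2 *
                                (fourier_sum p I (\<lambda>S. (1/2) ^ card S * a S) x)\<^sup>2)"
    by (simp flip: power_add)
  also have "\<dots> \<le> (\<Sum>S\<in>Pow I. ?l ^ card S * (upper_weight I a S * upper_weight I a S))"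
    using p I by (rule bilinear_hypercontractivity)
  also have "\<dots> \<le> (\<Sum>S\<in>Pow I. \<beta> * ?e * upper_weight I a S)"
  proof (rule sum_mono)
    fix S assume S: "S \<in> Pow I"
    \<comment> \<open>Only one factor is relaxed from \<open>a\<close> to \<open>c\<close>, to meet
      the hypothesis, whose power of \<lambda> then cancels. The other keeps its powers of
      \<open>r\<close>.\<close>
    have "upper_weight I a S \<le> upper_weight I c S"
      unfolding upper_weight_def by (rule sum_mono) (rule a_le)
    also have "\<dots> \<le> \<beta> * ?l powi (- int (card S)) * ?e"
      using global S by (simp add: c_def)
    finally have "?l ^ card S * upper_weight I a S
                    \<le> ?l ^ card S * (\<beta> * ?l powi (- int (card S)) * ?e)"
      using l by (intro mult_left_mono) auto
    also have "\<dots> = \<beta> * ?e"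
      using l by (simp add: power_int_minus field_simps)
    finally have "?l ^ card S * upper_weight I a S * upper_weight I a S
                    \<le> \<beta> * ?e * upper_weight I a S"
      by (intro mult_right_mono) auto
    then show "?l ^ card S * (upper_weight I a S * upper_weight I a S)
                 \<le> \<beta> * ?e * upper_weight I a S"
      by (simp add: mult.assoc)
  qed
  also have "\<dots> = \<beta> * ?e * (\<Sum>T\<in>Pow I. (2 * r\<^sup>2) ^ card T * (c T)\<^sup>2)"
    by (simp add: sum_distrib_left[symmetric] sum_upper_weight[OF I] sq power_mult_distrib mult.assoc)
  \<comment> \<open>The assumption on \<open>r\<close> bounds each weight
    \<open>(2 * r\<^sup>2) ^ card T\<close> by 1, which cancels the subset count.\<close>
  also have "\<dots> \<le> \<beta> * ?e * (\<Sum>T\<in>Pow I. (c T)\<^sup>2)"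
    using r e \<open>0 \<le> \<beta>\<close>
    by (intro mult_left_mono sum_mono mult_left_le_one_le power_le_one mult_nonneg_nonneg) auto
  also have "\<dots> = \<beta> * ?e\<^sup>2"
    by (simp only: c_def expectation_square[OF p I, of f, symmetric] power2_eq_square[of ?e] mult.assoc)
  finally show ?thesis .
qed

theorem theorem3p5:
  fixes n :: nat and p \<beta> :: real and f :: "(nat \<Rightarrow> bool) \<Rightarrow> real"
  assumes "0 < p" and "p < 1" and "\<beta> > 0"
    and "\<And>S. S \<subseteq> {1..n} \<Longrightarrow>
           (cube_norm p {1..n} 2 (deriv_op p {1..n} S f))\<^sup>2
             \<le> \<beta> * fourth_moment p powi (- int (card S)) * cube_expectation p {1..n} (\<lambda>x. (f x)\<^sup>2)"
  shows "cube_norm p {1..n} 4 (noise_op p {1..n} (1 / sqrt 24) f)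
           \<le> \<beta> powr (1 / 4) * cube_norm p {1..n} 2 f"
proof -
  let ?I = "{1..n}"
  \<comment> \<open>The preceding bound is applied with r = 1 / sqrt 6, for which 2 r^2 =
    1/3.\<close>
  have "sqrt 24 = sqrt (2\<^sup>2 * 6)" by simp
  then have s: "1 / sqrt 24 = (1 / sqrt 6) / 2"
    unfolding real_sqrt_mult by simp
  have "cube_norm p ?I 4 (noise_op p ?I (1 / sqrt 24) f)
          \<le> (\<beta> * (cube_expectation p ?I (\<lambda>x. (f x)\<^sup>2))\<^sup>2) powr (1 / 4)"
    unfolding cube_norm_4 s using assms
    by (intro powr_mono2 noise_op_fourth_moment_bound)
       (simp_all add: cube_norm_2_squared expectation_deriv_op_square power_divide)
  also have "\<dots> = (\<beta> * (cube_norm p ?I 2 f) ^ 4) powr (1 / 4)"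
    by (simp add: power_mult[symmetric] flip: cube_norm_2_squared)
  also have "\<dots> = \<beta> powr (1 / 4) * cube_norm p ?I 2 f"
  proof -
    have N: "0 \<le> cube_norm p ?I 2 f" by (simp add: cube_norm_def)
    then have "(cube_norm p ?I 2 f ^ 4) powr (1 / 4) = cube_norm p ?I 2 f"
      by (cases "cube_norm p ?I 2 f = 0") (auto simp: powr_powr simp flip: powr_numeral)
    then show ?thesis using assms(3) N by (simp add: powr_mult)
  qed
  finally show ?thesis .
qed

end
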